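(* Let $G$ be a finite simple graph and let $\widehat{G}$ be its associated $3$-uniform hypergraph. Then $G$ is strongly set-colorable if and only if there exists an integer $n>0$ such that $\widehat{G}$ is a $(2,3,2^{n}-1)$-packing of the Steiner triple system $S(2,3,2^{n}-1)$, where $S(2,3,2^n-1)$ denotes the projective Steiner triple system $\mathrm{PG}(n-1,2)$.
   Context: Let $G$ be a finite simple graph with vertex set $V(G)$ and edge set $E(G)$; $V(G)$ and $E(G)$ are regarded as disjoint sets, and the edge joining $u$ and $v$ is written $uv$. Strong set-coloring: let $X$ be a set of $n$ colors ($n$ a positive integer). A strong set-coloring of $G$ (with color set $X$) is a bijection $f: V(G)\cup E(G)\to 2^{X}\setminus\{\emptyset\}$ such that $f(uv)=f(u)\oplus f(v)$ for every edge $uv\in E(G)$, where $2^X$ is the power set of $X$ and $\oplus$ is symmetric difference of sets. $G$ is strongly set-colorable if such an $f$ exists for some finite nonempty color set $X$. Associated hypergraph: $\widehat{G}$ is the $3$-uniform hypergraph with vertex set $V(\widehat{G})=V(G)\cup E(G)$ and hyperedge set $E(\widehat{G})=\{\{u,v,uv\} : uv\in E(G)\}$. Steiner triple system: $S(2,3,2^n-1)$ denotes the system of points and lines of $\mathrm{PG}(n-1,2)$: its point set is $P=\mathbb{F}_2^n\setminus\{\mathbf 0\}$, so $|P|=2^n-1$, and its blocks are the $3$-element subsets $\{p,q,r\}\subseteq P$ with $p+q+r=\mathbf 0$ in $\mathbb{F}_2^n$. Packing: $\widehat{G}$ is a $(2,3,2^n-1)$-packing of $S(2,3,2^n-1)$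 if there is a bijection $\psi: V(G)\cup E(G)\to P$ (so in particular $|V(G)|+|E(G)|=2^n-1$) that sends every hyperedge $\{u,v,uv\}$ of $\widehat{G}$ to a block of $S(2,3,2^n-1)$, i.e. $\{\psi(u),\psi(v),\psi(uv)\}$ is a block for every $uv\in E(G)$. *)

theory Defs
  imports "HOL-Library.Z2" "Jordan_Normal_Form.Matrix"
begin

record 'v graph =
  vertices :: "'v set"
  edges :: "'v set set"

definition finite_simple_graph :: "'v graph \<Rightarrow> bool" where
  "finite_simple_graph G \<longleftrightarrow>
     finite (vertices G) \<and> (\<forall>e \<in> edges G. e \<subseteq> vertices G \<and> card e = 2)"

text \<open>
  The vertex set and the edge set are regarded as disjoint, so \<open>V(G) \<union> E(G)\<close> is rendered as the
  disjoint sum below: \<open>Inl u\<close> is the vertex \<open>u\<close> and \<open>Inr {u, v}\<close> is the edge \<open>uv\<close>.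
\<close>

definition elements :: "'v graph \<Rightarrow> ('v + 'v set) set" where
  "elements G = vertices G <+> edges G"

definition strong_set_coloring :: "'v graph \<Rightarrow> 'c set \<Rightarrow> ('v + 'v set \<Rightarrow> 'c set) \<Rightarrow> bool" where
  "strong_set_coloring G X f \<longleftrightarrow>
     bij_betw f (elements G) (Pow X - {{}}) \<and>
     (\<forall>u v. {u, v} \<in> edges G \<longrightarrow> f (Inr {u, v}) = sym_diff (f (Inl u)) (f (Inl v)))"

text \<open>
  Quantifying over colour sets inside a formula requires a fixed type of colours. Natural numbers
  suffice, since every finite set is equinumerous to a set of natural numbers; the lemma
  \<open>strongly_set_colorableI\<close> below shows that colours of any other type give nothing new.
\<close>

definition strongly_set_colorable :: "'v graph \<Rightarrow> bool" where
  "strongly_set_colorable G \<longleftrightarrow>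
     (\<exists>(X :: nat set) f. finite X \<and> X \<noteq> {} \<and> strong_set_coloring G X f)"

lemma strongly_set_colorableI:
  fixes X :: "'c set"
  assumes G: "finite_simple_graph G" and X: "finite X" "X \<noteq> {}"
    and f: "strong_set_coloring G X f"
  shows "strongly_set_colorable G"
proof -
  obtain g :: "'c \<Rightarrow> nat" where g: "inj_on g X"
    using X(1) finite_imp_inj_to_nat_seg by blast
  have bf: "bij_betw f (elements G) (Pow X - {{}})"
    using f by (simp add: strong_set_coloring_def)
  have "bij_betw ((`) g) (Pow X - {{}}) (Pow (g ` X) - {{}})"
  proof (rule bij_betw_imageI)
    show "inj_on ((`) g) (Pow X - {{}})"
      using inj_on_image_Pow[OF g] by (rule inj_on_subset) auto
    show "(`) g ` (Pow X - {{}}) = Pow (g ` X) - {{}}"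
      by (fastforce simp: subset_image_iff)
  qed
  with bf have bij: "bij_betw ((`) g \<circ> f) (elements G) (Pow (g ` X) - {{}})"
    by (rule bij_betw_trans)
  have "((`) g \<circ> f) (Inr {u, v}) = sym_diff (((`) g \<circ> f) (Inl u)) (((`) g \<circ> f) (Inl v))"
    if e: "{u, v} \<in> edges G" for u v
  proof -
    have "u \<in> vertices G" "v \<in> vertices G"
      using G e by (auto simp: finite_simple_graph_def)
    then have s: "f (Inl u) \<subseteq> X" "f (Inl v) \<subseteq> X"
      using bij_betwE[OF bf] by (auto simp: elements_def)
    have "f (Inr {u, v}) = sym_diff (f (Inl u)) (f (Inl v))"
      using f e unfolding strong_set_coloring_def by blast
    moreover have "g ` (f (Inl u) - f (Inl v)) = g ` f (Inl u) - g ` f (Inl v)"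
      using s by (intro inj_on_image_set_diff[OF g]) auto
    moreover have "g ` (f (Inl v) - f (Inl u)) = g ` f (Inl v) - g ` f (Inl u)"
      using s by (intro inj_on_image_set_diff[OF g]) auto
    ultimately show ?thesis
      by (simp only: comp_apply image_Un)
  qed
  with bij have "strong_set_coloring G (g ` X) ((`) g \<circ> f)"
    unfolding strong_set_coloring_def by blast
  with X show ?thesis
    unfolding strongly_set_colorable_def by (metis finite_imageI image_is_empty)
qed

record 'a hypergraph =
  points :: "'a set"
  blocks :: "'a set set"

definition associated_hypergraph :: "'v graph \<Rightarrow> ('v + 'v set) hypergraph" where
  "associated_hypergraph G =
     \<lparr>points = elements G,
      blocks = {{Inl u, Inl v, Inr {u, v}} | u v. {u, v} \<in> edges G}\<rparr>"

text \<open>The points and lines of \<open>PG(n - 1, 2)\<close>; \<open>bit\<close> is the field with two elements.\<close>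

definition pg_points :: "nat \<Rightarrow> bit vec set" where
  "pg_points n = carrier_vec n - {0\<^sub>v n}"

definition projective_STS :: "nat \<Rightarrow> bit vec hypergraph" where
  "projective_STS n =
     \<lparr>points = pg_points n,
      blocks = {{p, q, r} | p q r.
        {p, q, r} \<subseteq> pg_points n \<and> card {p, q, r} = 3 \<and> p + q + r = 0\<^sub>v n}\<rparr>"

text \<open>The parameters of a \<open>(2, 3, 2\<^sup>n - 1)\<close>-packing are those of the Steiner system \<open>S\<close>.\<close>

definition is_packing_of :: "'a hypergraph \<Rightarrow> 'b hypergraph \<Rightarrow> bool" where
  "is_packing_of H S \<longleftrightarrow>
     (\<exists>\<psi>. bij_betw \<psi> (points H) (points S) \<and> (\<forall>h \<in> blocks H. \<psi> ` h \<in> blocks S))"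

end

theory Submission
  imports Defs
begin

text \<open>
  Enumerating the colours as \<open>x\<^sub>0, \<dots>, x\<^sub>n\<^sub>-\<^sub>1\<close> identifies a subset of \<open>X\<close> with its
  characteristic vector in \<open>\<bbbF>\<^sub>2\<^sup>n\<close>. This identification turns symmetric difference
  into addition (\<open>char_vec_sym_diff\<close>) and the nonempty sets into the points of \<open>PG(n - 1, 2)\<close>
  (\<open>bij_betw_char_vec_pg_points\<close>). Over \<open>\<bbbF>\<^sub>2\<close> the equation \<open>p + q + r = 0\<close> says
  \<open>r = p + q\<close>, so three points form a line exactly when one is the sum of the other two
  (\<open>line_iff_sum\<close>), and the colouring rule on an edge \<open>uv\<close> is literally the condition that
  \<open>{u, v, uv}\<close> is sent to a line. Hence composition with the identification carries the strong
  set-colourings to the packings, and its inverse carries them back.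
\<close>

section \<open>Characteristic vectors\<close>

text \<open>
  A colour set comes without an order, whereas coordinates are numbered; the enumeration \<open>e\<close> of the
  colours mediates between the two.
\<close>

definition char_vec :: "nat \<Rightarrow> (nat \<Rightarrow> 'c) \<Rightarrow> 'c set \<Rightarrow> bit vec" where
  "char_vec n e A = vec n (\<lambda>i. of_bool (e i \<in> A))"

lemma char_vec_carrier [simp]: "char_vec n e A \<in> carrier_vec n"
  by (simp add: char_vec_def)

lemma char_vec_empty: "char_vec n e {} = 0\<^sub>v n"
  by (rule eq_vecI) (simp_all add: char_vec_def)

lemma char_vec_sym_diff:
  "char_vec n e (sym_diff A B) = char_vec n e A + char_vec n e B"
  by (rule eq_vecI) (auto simp: char_vec_def)

lemma bij_betw_char_vec:
  assumes e: "bij_betw e {..<n} X"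
  shows "bij_betw (char_vec n e) (Pow X) (carrier_vec n)"
proof (rule bij_betw_imageI)
  have X: "X = e ` {..<n}"
    using e by (simp add: bij_betw_def)
  show "inj_on (char_vec n e) (Pow X)"
  proof (rule inj_onI)
    fix A B assume AB: "A \<in> Pow X" "B \<in> Pow X" and eq: "char_vec n e A = char_vec n e B"
    have "e i \<in> A \<longleftrightarrow> e i \<in> B" if "i < n" for i
      using arg_cong[OF eq, of "\<lambda>v. v $ i"] that
      by (simp add: char_vec_def of_bool_eq_iff)
    then show "A = B"
      using AB X by blast
  qed
  show "char_vec n e ` Pow X = carrier_vec n"
  proof (intro equalityI subsetI)
    fix v :: "bit vec" assume v: "v \<in> carrier_vec n"
    let ?A = "e ` {i. i < n \<and> v $ i = 1}"
    have "e i \<in> ?A \<longleftrightarrow> v $ i = 1" if "i < n" for i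
      using that bij_betw_imp_inj_on[OF e] by (auto dest: inj_onD)
    then have "char_vec n e ?A = v"
      using v by (intro eq_vecI) (auto simp: char_vec_def)
    moreover have "?A \<in> Pow X"
      using X by auto
    ultimately show "v \<in> char_vec n e ` Pow X"
      by (intro image_eqI[of v _ ?A]) auto
  qed auto
qed

lemma bij_betw_char_vec_pg_points:
  assumes "bij_betw e {..<n} X"
  shows "bij_betw (char_vec n e) (Pow X - {{}}) (pg_points n)"
  unfolding pg_points_def
  using bij_betw_DiffI[OF bij_betw_char_vec[OF assms], of "{{}}" "{0\<^sub>v n}"]
  by (simp add: char_vec_empty bij_betw_def)

section \<open>Lines of the projective space\<close>

lemma bit_vec_sum_zero_iff:
  fixes p q r :: "bit vec"
  assumes "p \<in> carrier_vec n" "q \<in> carrier_vec n" "r \<in> carrier_vec n"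
  shows "p + q + r = 0\<^sub>v n \<longleftrightarrow> r = p + q"
proof -
  have "a + b + c = 0 \<longleftrightarrow> c = a + b" for a b c :: bit
    by (cases a; cases b; cases c) simp_all
  then show ?thesis
    using assms by (auto simp: vec_eq_iff)
qed

text \<open>
  A block is given only as a set, so its zero-sum condition is known for some ordering of its
  elements; commutativity of addition makes the ordering irrelevant. Conversely, three nonzero
  vectors with \<open>r = p + q\<close> are automatically distinct, because any coincidence would force the
  remaining one to vanish.
\<close>

lemma line_iff_sum:
  assumes pts: "p \<in> pg_points n" "q \<in> pg_points n" "r \<in> pg_points n"
  shows "{p, q, r} \<in> blocks (projective_STS n) \<longleftrightarrow> r = p + q"
proof
  have c: "p \<in> carrier_vec n" "q \<in> carrier_vec n" "r \<in> carrier_vec n"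
    and nz: "p \<noteq> 0\<^sub>v n" "q \<noteq> 0\<^sub>v n" "r \<noteq> 0\<^sub>v n"
    using pts by (auto simp: pg_points_def)
  {
    assume "{p, q, r} \<in> blocks (projective_STS n)"
    then obtain a b c' where eq: "{p, q, r} = {a, b, c'}" and 3: "card {a, b, c'} = 3"
      and sub: "{a, b, c'} \<subseteq> pg_points n" and z: "a + b + c' = 0\<^sub>v n"
      by (auto simp: projective_STS_def)
    have ab: "a \<in> carrier_vec n" "b \<in> carrier_vec n" "c' \<in> carrier_vec n"
      using sub by (auto simp: pg_points_def)
    have "a \<noteq> b" "a \<noteq> c'" "b \<noteq> c'"
      using 3 by (auto simp: card_insert_if split: if_splits)
    moreover have "p \<noteq> q" "p \<noteq> r" "q \<noteq> r"
      using 3 by (auto simp: card_insert_if simp flip: eq split: if_splits)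
    ultimately have "(p = a \<and> q = b \<and> r = c') \<or> (p = a \<and> q = c' \<and> r = b) \<or>
        (p = b \<and> q = a \<and> r = c') \<or> (p = b \<and> q = c' \<and> r = a) \<or>
        (p = c' \<and> q = a \<and> r = b) \<or> (p = c' \<and> q = b \<and> r = a)"
      using eq by (smt (verit) insert_iff singletonD)
    moreover have "a + c' + b = a + b + c'" "b + a + c' = a + b + c'" "b + c' + a = a + b + c'"
        "c' + a + b = a + b + c'" "c' + b + a = a + b + c'"
      using ab by (auto simp: vec_eq_iff ac_simps)
    ultimately have "p + q + r = 0\<^sub>v n"
      using z by auto
    then show "r = p + q"
      by (rule bit_vec_sum_zero_iff[OF c, THEN iffD1])
  }
  {
    assume r: "r = p + q"
    have pq: "p \<noteq> q"
      using bit_vec_sum_zero_iff[of p n q "0\<^sub>v n"] c nz r by auto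
    have "r \<noteq> p" "r \<noteq> q"
      using c nz r by (auto simp: vec_eq_iff)
    with pq have "card {p, q, r} = 3"
      by auto
    moreover have "p + q + r = 0\<^sub>v n"
      by (rule bit_vec_sum_zero_iff[OF c, THEN iffD2, OF r])
    ultimately show "{p, q, r} \<in> blocks (projective_STS n)"
      using pts unfolding projective_STS_def by auto
  }
qed

section \<open>Colourings and packings\<close>

lemma points_associated_hypergraph: "points (associated_hypergraph G) = elements G"
  by (simp add: associated_hypergraph_def)

lemma points_projective_STS: "points (projective_STS n) = pg_points n"
  by (simp add: projective_STS_def)

text \<open>
  The correspondence for one fixed map: since \<open>char_vec\<close> is injective, equality of the colour sets
  \<open>f(uv)\<close> and \<open>f(u) \<oplus> f(v)\<close> can be tested on characteristic vectors, where it is the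
  equation of a line.
\<close>

lemma strong_set_coloring_iff_packing_map:
  assumes G: "finite_simple_graph G" and e: "bij_betw e {..<n} X"
    and f: "f ` elements G \<subseteq> Pow X - {{}}"
  shows "strong_set_coloring G X f \<longleftrightarrow>
    bij_betw (char_vec n e \<circ> f) (elements G) (pg_points n) \<and>
    (\<forall>h \<in> blocks (associated_hypergraph G). (char_vec n e \<circ> f) ` h \<in> blocks (projective_STS n))"
proof -
  let ?\<chi> = "char_vec n e"
  note bij = bij_betw_char_vec_pg_points[OF e]
  have edge: "f (Inr {u, v}) = sym_diff (f (Inl u)) (f (Inl v)) \<longleftrightarrow>
      (?\<chi> \<circ> f) ` {Inl u, Inl v, Inr {u, v}} \<in> blocks (projective_STS n)"
    if uv: "{u, v} \<in> edges G" for u v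
  proof -
    have "u \<in> vertices G" "v \<in> vertices G"
      using G uv by (auto simp: finite_simple_graph_def)
    then have el: "Inl u \<in> elements G" "Inl v \<in> elements G" "Inr {u, v} \<in> elements G"
      using uv by (auto simp: elements_def)
    then have s: "f (Inl u) \<in> Pow X - {{}}" "f (Inl v) \<in> Pow X - {{}}"
        "f (Inr {u, v}) \<in> Pow X - {{}}"
      using f by blast+
    have "f (Inr {u, v}) = sym_diff (f (Inl u)) (f (Inl v)) \<longleftrightarrow>
        ?\<chi> (f (Inr {u, v})) = ?\<chi> (sym_diff (f (Inl u)) (f (Inl v)))"
      using s by (intro inj_on_eq_iff[OF bij_betw_imp_inj_on[OF bij_betw_char_vec[OF e]], symmetric])
        auto
    also have "\<dots> \<longleftrightarrow> ?\<chi> (f (Inr {u, v})) = ?\<chi> (f (Inl u)) + ?\<chi> (f (Inl v))"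
      by (simp only: char_vec_sym_diff)
    also have "\<dots> \<longleftrightarrow>
        {?\<chi> (f (Inl u)), ?\<chi> (f (Inl v)), ?\<chi> (f (Inr {u, v}))} \<in> blocks (projective_STS n)"
      using s[THEN bij_betwE[OF bij, rule_format]] by (rule line_iff_sum[symmetric])
    finally show ?thesis
      by simp
  qed
  have "(\<forall>h \<in> blocks (associated_hypergraph G). (?\<chi> \<circ> f) ` h \<in> blocks (projective_STS n)) \<longleftrightarrow>
      (\<forall>u v. {u, v} \<in> edges G \<longrightarrow>
        (?\<chi> \<circ> f) ` {Inl u, Inl v, Inr {u, v}} \<in> blocks (projective_STS n))"
    unfolding associated_hypergraph_def by (simp del: comp_apply image_insert) blast
  then show ?thesis
    unfolding strong_set_coloring_def bij_betw_comp_iff2[OF bij f] using edge by blast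
qed

theorem theorem3p1:
  fixes G :: "'v graph"
  assumes "finite_simple_graph G"
  shows "strongly_set_colorable G \<longleftrightarrow>
    (\<exists>n :: nat. n > 0 \<and> is_packing_of (associated_hypergraph G) (projective_STS n))"
proof
  assume "strongly_set_colorable G"
  then obtain X :: "nat set" and f where X: "finite X" "X \<noteq> {}" and f: "strong_set_coloring G X f"
    by (auto simp: strongly_set_colorable_def)
  obtain e where e: "bij_betw e {..<card X} X"
    using ex_bij_betw_nat_finite[OF X(1)] by (auto simp: atLeast0LessThan)
  have "f ` elements G \<subseteq> Pow X - {{}}"
    using f by (auto simp: strong_set_coloring_def bij_betw_def)
  from strong_set_coloring_iff_packing_map[OF assms e this, THEN iffD1, OF f]
  have "is_packing_of (associated_hypergraph G) (projective_STS (card X))"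
    unfolding is_packing_of_def points_associated_hypergraph points_projective_STS
    by (rule exI[of _ "char_vec (card X) e \<circ> f"])
  moreover have "card X > 0"
    using X by (simp add: card_gt_0_iff)
  ultimately show "\<exists>n :: nat. n > 0 \<and> is_packing_of (associated_hypergraph G) (projective_STS n)"
    by blast
next
  assume "\<exists>n :: nat. n > 0 \<and> is_packing_of (associated_hypergraph G) (projective_STS n)"
  then obtain n \<psi> where n: "n > 0" and \<psi>: "bij_betw \<psi> (elements G) (pg_points n)"
    and lines: "\<forall>h \<in> blocks (associated_hypergraph G). \<psi> ` h \<in> blocks (projective_STS n)"
    by (auto simp: is_packing_of_def points_associated_hypergraph points_projective_STS)
  \<comment> \<open>The coordinates themselves serve as colours.\<close>
  let ?X = "{..<n}" and ?\<chi> = "char_vec n id"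
  let ?f = "inv_into (Pow ?X - {{}}) ?\<chi> \<circ> \<psi>"
  have e: "bij_betw id {..<n} ?X"
    by simp
  note bij = bij_betw_char_vec_pg_points[OF e]
  have "bij_betw ?f (elements G) (Pow ?X - {{}})"
    using \<psi> bij_betw_inv_into[OF bij] by (rule bij_betw_trans)
  then have f: "?f ` elements G \<subseteq> Pow ?X - {{}}"
    by (simp add: bij_betw_def)
  have eq: "(?\<chi> \<circ> ?f) x = \<psi> x" if "x \<in> elements G" for x
    using bij_betw_inv_into_right[OF bij] bij_betwE[OF \<psi>] that by simp
  have "h \<subseteq> elements G" if "h \<in> blocks (associated_hypergraph G)" for h
    using that assms
    by (fastforce simp: associated_hypergraph_def elements_def finite_simple_graph_def)
  then have "(?\<chi> \<circ> ?f) ` h = \<psi> ` h" if "h \<in> blocks (associated_hypergraph G)" for h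
    using that eq by (intro image_cong) blast+
  moreover have "bij_betw (?\<chi> \<circ> ?f) (elements G) (pg_points n)"
    using \<psi> bij_betw_cong[of "elements G" "?\<chi> \<circ> ?f" \<psi>] eq by blast
  ultimately have "strong_set_coloring G ?X ?f"
    using strong_set_coloring_iff_packing_map[OF assms e f] lines by simp
  moreover have "finite ?X" "?X \<noteq> {}"
    using n by auto
  ultimately show "strongly_set_colorable G"
    unfolding strongly_set_colorable_def by blast
qed

end
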